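(* The class of $\iota$-acyclic hypergraphs is a strict superset of the class of Berge-acyclic hypergraphs, and it is a strict subset of the class of $\gamma$-acyclic hypergraphs.
   Context: A (multi-)hypergraph $\mathcal H=(\mathcal V,\mathcal E)$ has a finite set $\mathcal V$ of vertices and a finite multiset $\mathcal E$ of non-empty subsets of $\mathcal V$ (hyperedges), labelled so that equal hyperedges are distinguishable (and count as distinct hyperedges). $\mathcal E_u$ is the set of (labelled) hyperedges containing $u$. The transformation $\tau$. For each vertex $u\in\mathcal V$ let $n_u=|\mathcal E_u|$ and introduce fresh vertices $\tilde u_1,\dots,\tilde u_{n_u}$. For each choice of one permutation $\sigma^u=(\sigma^u_1,\dots,\sigma^u_{n_u})$ of $\mathcal E_u$ for every $u\in\mathcal V$, let $\tilde{\mathcal H}$ be the hypergraph with vertices $\bigcup_u\{\tilde u_1,\dots,\tilde u_{n_u}\}$ and one hyperedge $\tilde e=\bigcup_{u\in e}\{\tilde u_1,\dots,\tilde u_{p_u(e)}\}$ for each $e\in\mathcal E$, where $p_u(e)$ is the position of $e$ in $\sigma^u$. Then $\tau(\mathcal H)$ is the set of all hypergraphs $\tilde{\mathcal H}$ so obtained. $\alpha$-acyclicity. A hypergraph is $\alpha$-acyclic iff it has a join tree: a tree $\mathcal T$ with a bijection $\chi$ from its nodes to the (labelled) hyperedges such that for every vertex $v$ the set $\{t: v\in\chi(t)\}$ is a connected subtree. $\iota$-acyclicity. $\mathcal H$ is $\iota$-acyclic iff every hypergraph in $\tau(\mathcal H)$ is $\alpha$-acyclic. Berge-acyclicity. A Berge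 cycle of length $n$ in $\mathcal H$ is a sequence $(e^1,v^1,\dots,e^n,v^n,e^{n+1})$ such that $v^1,\dots,v^n$ are distinct vertices, $e^1,\dots,e^n$ are distinct hyperedges, $e^{n+1}=e^1$, $n\ge2$, and $v^i\in e^i\cap e^{i+1}$ for each $1\le i\le n$. $\mathcal H$ is Berge-acyclic if it has no Berge cycle. $\gamma$-acyclicity. For $S\subseteq\mathcal V$ let $\mathcal E[S]=\{e\cap S: e\in\mathcal E\}\setminus\{\emptyset\}$ (a set of sets). For a family $\mathcal F$ of sets let $\mathcal M(\mathcal F)$ be the set of inclusion-maximal members of $\mathcal F$. $\mathcal H$ is cycle-free if there is no tuple $(v^1,\dots,v^n)$, $n\ge3$, of pairwise distinct vertices with $\mathcal M(\mathcal E[\{v^1,\dots,v^n\}])=\{\{v^i,v^{i+1}\}:1\le i<n\}\cup\{\{v^n,v^1\}\}$. $\mathcal H$ is $\gamma$-acyclic if it is cycle-free and there are no pairwise distinct $x,y,z\in\mathcal V$ with $\{\{x,y\},\{x,z\},\{x,y,z\}\}\subseteq\mathcal E[\{x,y,z\}]$. *)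

theory Defs
  imports Main "HOL-Library.Infinite_Typeclass"
begin

text \<open>
  A multi-hypergraph is given by its vertices, a set of hyperedge labels, and the vertex set of
  each label. Different labels may carry equal vertex sets and then count as different hyperedges.
  The value of \<open>vset\<close> outside \<open>labels\<close> is irrelevant.
\<close>

record ('v, 'e) hypergraph =
  verts :: "'v set"
  labels :: "'e set"
  vset :: "'e \<Rightarrow> 'v set"

definition hypergraphs :: "('v, 'e) hypergraph set" where
  "hypergraphs = {H. finite (verts H) \<and> finite (labels H) \<and>
     (\<forall>e\<in>labels H. vset H e \<noteq> {} \<and> vset H e \<subseteq> verts H)}"

definition star :: "('v, 'e) hypergraph \<Rightarrow> 'v \<Rightarrow> 'e set" where
  "star H u = {e \<in> labels H. u \<in> vset H e}"


section \<open>The transformation \<open>\<tau>\<close>\<close>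

text \<open>
  The fresh vertex $\tilde u_i$ is the pair \<open>(u, i)\<close>, with \<open>i\<close> counted from 1. The permutation
  of \<open>star H u\<close> is the map sending the position \<open>i\<close> to the hyperedge \<open>\<sigma> u i\<close>.
\<close>

definition position ::
    "('v, 'e) hypergraph \<Rightarrow> ('v \<Rightarrow> nat \<Rightarrow> 'e) \<Rightarrow> 'v \<Rightarrow> 'e \<Rightarrow> nat" where
  "position H \<sigma> u e = inv_into {1..card (star H u)} (\<sigma> u) e"

definition expand ::
    "('v, 'e) hypergraph \<Rightarrow> ('v \<Rightarrow> nat \<Rightarrow> 'e) \<Rightarrow> ('v \<times> nat, 'e) hypergraph" where
  "expand H \<sigma> =
     \<lparr> verts = (\<Union>u\<in>verts H. {u} \<times> {1..card (star H u)}),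
       labels = labels H,
       vset = (\<lambda>e. \<Union>u\<in>vset H e. {u} \<times> {1..position H \<sigma> u e}) \<rparr>"

definition tau :: "('v, 'e) hypergraph \<Rightarrow> ('v \<times> nat, 'e) hypergraph set" where
  "tau H = {expand H \<sigma> | \<sigma>. \<forall>u\<in>verts H. bij_betw (\<sigma> u) {1..card (star H u)} (star H u)}"


section \<open>\<open>\<alpha>\<close>-acyclicity and \<open>\<iota>\<close>-acyclicity\<close>

text \<open>
  An undirected graph on the nodes \<open>N\<close> is given by its symmetric adjacency relation \<open>F\<close>.
  The empty set counts as connected, so that the empty graph is a tree; a hypergraph without
  hyperedges then has the empty join tree. In a tree the subtrees are the subgraphs induced by
  connected sets of nodes.
\<close>

definition connected_on :: "('t \<times> 't) set \<Rightarrow> 't set \<Rightarrow> bool" where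
  "connected_on F S \<longleftrightarrow> (\<forall>s\<in>S. \<forall>t\<in>S. (s, t) \<in> (F \<inter> S \<times> S)\<^sup>*)"

definition graph_cycle :: "('t \<times> 't) set \<Rightarrow> 't list \<Rightarrow> bool" where
  "graph_cycle F c \<longleftrightarrow> 3 \<le> length c \<and> distinct c \<and>
     (\<forall>i<length c. (c ! i, c ! (Suc i mod length c)) \<in> F)"

definition is_tree :: "'t set \<Rightarrow> ('t \<times> 't) set \<Rightarrow> bool" where
  "is_tree N F \<longleftrightarrow> finite N \<and> F \<subseteq> N \<times> N \<and> sym F \<and> irrefl F \<and>
     connected_on F N \<and> (\<nexists>c. graph_cycle F c)"

definition is_join_tree ::
    "('v, 'e) hypergraph \<Rightarrow> 't set \<Rightarrow> ('t \<times> 't) set \<Rightarrow> ('t \<Rightarrow> 'e) \<Rightarrow> bool" where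
  "is_join_tree H N F \<chi> \<longleftrightarrow> is_tree N F \<and> bij_betw \<chi> N (labels H) \<and>
     (\<forall>v\<in>verts H. connected_on F {t \<in> N. v \<in> vset H (\<chi> t)})"

text \<open>Trees being finite, it is no restriction to take natural numbers as their nodes.\<close>

definition alpha_acyclic :: "('v, 'e) hypergraph \<Rightarrow> bool" where
  "alpha_acyclic H \<longleftrightarrow>
     (\<exists>(N :: nat set) (F :: (nat \<times> nat) set) (\<chi> :: nat \<Rightarrow> 'e). is_join_tree H N F \<chi>)"

definition iota_acyclic :: "('v, 'e) hypergraph \<Rightarrow> bool" where
  "iota_acyclic H \<longleftrightarrow> (\<forall>H'\<in>tau H. alpha_acyclic H')"


section \<open>Berge-acyclicity\<close>

definition berge_cycle ::
    "('v, 'e) hypergraph \<Rightarrow> nat \<Rightarrow> (nat \<Rightarrow> 'e) \<Rightarrow> (nat \<Rightarrow> 'v) \<Rightarrow> bool" where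
  "berge_cycle H n e v \<longleftrightarrow> n \<ge> 2 \<and>
     inj_on v {1..n} \<and> v ` {1..n} \<subseteq> verts H \<and>
     inj_on e {1..n} \<and> e ` {1..n} \<subseteq> labels H \<and> e (n + 1) = e 1 \<and>
     (\<forall>i\<in>{1..n}. v i \<in> vset H (e i) \<inter> vset H (e (i + 1)))"

definition berge_acyclic :: "('v, 'e) hypergraph \<Rightarrow> bool" where
  "berge_acyclic H \<longleftrightarrow> (\<nexists>n e v. berge_cycle H n e v)"


section \<open>\<open>\<gamma>\<close>-acyclicity\<close>

definition trace :: "('v, 'e) hypergraph \<Rightarrow> 'v set \<Rightarrow> 'v set set" where
  "trace H S = {vset H e \<inter> S | e. e \<in> labels H} - {{}}"

definition maximal_sets :: "'v set set \<Rightarrow> 'v set set" where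
  "maximal_sets \<F> = {A \<in> \<F>. \<nexists>B. B \<in> \<F> \<and> A \<subset> B}"

definition cycle_free :: "('v, 'e) hypergraph \<Rightarrow> bool" where
  "cycle_free H \<longleftrightarrow> \<not> (\<exists>n (v :: nat \<Rightarrow> 'v). n \<ge> 3 \<and> inj_on v {1..n} \<and> v ` {1..n} \<subseteq> verts H \<and>
     maximal_sets (trace H (v ` {1..n})) = {{v i, v (i + 1)} | i. 1 \<le> i \<and> i < n} \<union> {{v n, v 1}})"

definition gamma_acyclic :: "('v, 'e) hypergraph \<Rightarrow> bool" where
  "gamma_acyclic H \<longleftrightarrow> cycle_free H \<and>
     \<not> (\<exists>x\<in>verts H. \<exists>y\<in>verts H. \<exists>z\<in>verts H. x \<noteq> y \<and> x \<noteq> z \<and> y \<noteq> z \<and>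
          {{x, y}, {x, z}, {x, y, z}} \<subseteq> trace H {x, y, z})"


section \<open>The classes of hypergraphs\<close>

definition berge_acyclic_class :: "('v, 'e) hypergraph set" where
  "berge_acyclic_class = {H \<in> hypergraphs. berge_acyclic H}"

definition iota_acyclic_class :: "('v, 'e) hypergraph set" where
  "iota_acyclic_class = {H \<in> hypergraphs. iota_acyclic H}"

definition gamma_acyclic_class :: "('v, 'e) hypergraph set" where
  "gamma_acyclic_class = {H \<in> hypergraphs. gamma_acyclic H}"

end

theory Submission
  imports Defs
begin

text \<open>
  A finite hypergraph has a join tree iff its hyperedges can be listed so that each one meets the
  union of its predecessors inside a single predecessor (the running intersection property).

  The copies of a vertex \<open>u\<close> in a member of \<open>\<tau> H\<close> lie in the hyperedges of the nonempty suffixes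
  of the chosen permutation of \<open>star H u\<close>. If \<open>H\<close> is Berge-acyclic, every nonempty set of hyperedges
  has a member sharing at most one vertex \<open>u\<close> with the others, and it can be attached to the other
  hyperedge with the largest position at \<open>u\<close>; this gives the listing for every choice of the
  permutations. Conversely, any subset of \<open>star H u\<close> is a suffix of some permutation. Taking
  all of \<open>star H u\<close> shows that \<open>H\<close> itself is \<open>\<alpha>\<close>-acyclic and hence cycle-free; taking
  the two hyperedges behind \<open>{x, y}\<close> and \<open>{x, z}\<close> as a suffix at \<open>x\<close> turns a \<open>\<gamma>\<close>-triangle
  into a violation of the Helly property of subtrees.

  Two copies of \<open>{a, b}\<close> separate Berge- from \<open>\<iota>\<close>-acyclicity, and three copies of \<open>{a, b, c}\<close>
  separate \<open>\<iota>\<close>- from \<open>\<gamma>\<close>-acyclicity.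
\<close>

section \<open>The running intersection property\<close>

text \<open>The listing is the order of insertion. Keeping \<open>f\<close> apart from the labels
  lets one listing serve several vertex assignments. A nonempty \<open>N\<close> must offer some
  \<open>p\<close> even if \<open>f e\<close> meets nothing there, so that the join tree comes out
  connected.\<close>

inductive running_intersection :: "('e \<Rightarrow> 'v set) \<Rightarrow> 'e set \<Rightarrow> bool" for f where
  empty: "running_intersection f {}"
| insert: "running_intersection f N \<Longrightarrow> e \<notin> N \<Longrightarrow> N = {} \<or> (\<exists>p\<in>N. f e \<inter> \<Union>(f ` N) \<subseteq> f p)
    \<Longrightarrow> running_intersection f (insert e N)"

text \<open>Each vertex of \<open>g\<close> behaves like a copy of some vertex of \<open>f\<close>,
  so the same listing works. This covers both restriction to a set of vertices and the choice of
  copies in an expansion.\<close>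

lemma running_intersection_select:
  assumes "running_intersection f N"
    and "\<And>v. v \<in> \<Union>(g ` N) \<Longrightarrow> \<exists>w. \<forall>e\<in>N. v \<in> g e \<longleftrightarrow> w \<in> f e"
  shows "running_intersection g N"
  using assms
proof (induction rule: running_intersection.induct)
  case empty
  show ?case by (rule running_intersection.empty)
next
  case (insert N e)
  have "\<exists>w. \<forall>e\<in>N. v \<in> g e \<longleftrightarrow> w \<in> f e" if "v \<in> \<Union>(g ` N)" for v
    using insert.prems[of v] that by blast
  then have ri: "running_intersection g N"
    by (rule insert.IH)
  have "g e \<inter> \<Union>(g ` N) \<subseteq> g p" if p: "p \<in> N" "f e \<inter> \<Union>(f ` N) \<subseteq> f p" for p
  proof
    fix v assume v: "v \<in> g e \<inter> \<Union>(g ` N)"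
    then obtain w where "\<forall>e'\<in>insert e N. v \<in> g e' \<longleftrightarrow> w \<in> f e'"
      using insert.prems[of v] by blast
    with v p show "v \<in> g p" by blast
  qed
  with insert.hyps ri show ?case
    by (meson running_intersection.insert)
qed

lemma running_intersection_image:
  assumes "running_intersection (\<lambda>t. f (\<chi> t)) N" "inj_on \<chi> N"
  shows "running_intersection f (\<chi> ` N)"
  using assms
proof (induction rule: running_intersection.induct)
  case empty
  show ?case by (simp add: running_intersection.empty)
next
  case (insert N t)
  then have "running_intersection f (\<chi> ` N)" "\<chi> t \<notin> \<chi> ` N"
    by auto
  moreover have "\<chi> ` N = {} \<or> (\<exists>p\<in>\<chi> ` N. f (\<chi> t) \<inter> \<Union>(f ` \<chi> ` N) \<subseteq> f p)"
    using insert.hyps(3) by (auto simp: image_image)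
  ultimately show ?case
    by (simp add: running_intersection.insert)
qed

text \<open>A newest hyperedge missing one of the three vertices covers at most one of the pairs,
  and \<open>p\<close> covers that pair as well. So all pairs are covered earlier.\<close>

lemma running_intersection_Helly:
  assumes "running_intersection f N"
    and "\<exists>e\<in>N. {x, y} \<subseteq> f e" "\<exists>e\<in>N. {x, z} \<subseteq> f e" "\<exists>e\<in>N. {y, z} \<subseteq> f e"
  shows "\<exists>e\<in>N. {x, y, z} \<subseteq> f e"
  using assms
proof (induction rule: running_intersection.induct)
  case empty
  then show ?case by simp
next
  case (insert N e)
  show ?case
  proof (cases "{x, y, z} \<subseteq> f e")
    case False
    then obtain p where p: "p \<in> N" "f e \<inter> \<Union>(f ` N) \<subseteq> f p"
      using insert.hyps(3) insert.prems by auto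
    obtain e1 e2 e3 where e: "e1 \<in> insert e N" "{x, y} \<subseteq> f e1"
        "e2 \<in> insert e N" "{x, z} \<subseteq> f e2" "e3 \<in> insert e N" "{y, z} \<subseteq> f e3"
      using insert.prems by metis
    \<comment> \<open>The vertex missed by \<open>e\<close> occurs in two of the pairs; their
      hyperedges are older and together contain all three vertices.\<close>
    have old: "x \<in> \<Union>(f ` N)" "y \<in> \<Union>(f ` N)" "z \<in> \<Union>(f ` N)"
      using e False by auto
    have "\<exists>e'\<in>N. {u, v} \<subseteq> f e'"
      if "u \<in> \<Union>(f ` N)" "v \<in> \<Union>(f ` N)" "e' \<in> insert e N" "{u, v} \<subseteq> f e'" for u v e'
    proof (cases "e' = e")
      case True
      then have "{u, v} \<subseteq> f p" using p(2) that by auto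
      with p(1) show ?thesis by blast
    qed (use that in auto)
    then have "\<exists>e\<in>N. {x, y, z} \<subseteq> f e"
      using e old by (intro insert.IH) metis+
    then show ?thesis by blast
  qed blast
qed

lemma maximal_sets_insert:
  assumes "X \<subseteq> P" "P \<in> \<F>"
  shows "maximal_sets (insert X \<F>) = maximal_sets \<F>"
proof -
  have "(\<exists>B. B \<in> insert X \<F> \<and> A \<subset> B) \<longleftrightarrow> (\<exists>B. B \<in> \<F> \<and> A \<subset> B)" for A
    using assms by (metis insert_iff psubset_subset_trans)
  moreover have "X \<in> \<F> \<or> (\<exists>B. B \<in> \<F> \<and> X \<subset> B)"
    using assms by (metis psubsetI)
  ultimately show ?thesis unfolding maximal_sets_def by (metis insert_iff)
qed

text \<open>The last hyperedge not inside an earlier one brings in a new vertex, which lies in no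
  other maximal set. Hyperedges inside an earlier one do not affect the maximal sets.\<close>

lemma running_intersection_ear:
  assumes "running_intersection f N" "\<Union>(f ` N) \<noteq> {}"
  shows "\<exists>v\<in>\<Union>(f ` N). \<forall>A\<in>maximal_sets (f ` N). \<forall>B\<in>maximal_sets (f ` N).
    v \<in> A \<longrightarrow> v \<in> B \<longrightarrow> A = B"
  using assms
proof (induction rule: running_intersection.induct)
  case empty
  then show ?case by simp
next
  case (insert N e)
  show ?case
  proof (cases "\<exists>p\<in>N. f e \<subseteq> f p")
    case True
    then have "maximal_sets (f ` insert e N) = maximal_sets (f ` N)"
      using maximal_sets_insert[of "f e" _ "f ` N"] by auto
    moreover have "\<Union>(f ` insert e N) = \<Union>(f ` N)" using True by auto
    ultimately show ?thesis using insert.IH insert.prems by simp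
  next
    case False
    \<comment> \<open>Otherwise \<open>f e\<close> would lie inside \<open>f p\<close>; for
      \<open>N = {}\<close> the nonempty union supplies the vertex.\<close>
    have "\<exists>v\<in>f e. v \<notin> \<Union>(f ` N)"
      using False insert.hyps(3) insert.prems by blast
    then obtain v where v: "v \<in> f e" "v \<notin> \<Union>(f ` N)" by blast
    then have "A = f e" if "A \<in> maximal_sets (f ` insert e N)" "v \<in> A" for A
      using that unfolding maximal_sets_def by blast
    with v(1) show ?thesis by blast
  qed
qed

section \<open>Join trees\<close>

lemma sequence_collision:
  fixes s :: "nat \<Rightarrow> 'a"
  assumes "finite A" "range s \<subseteq> A"
  shows "\<exists>i d. 0 < d \<and> s i = s (i + d)"
proof -
  have "\<not> inj s"
    using assms by (meson finite_subset infinite_UNIV_nat finite_imageD)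
  then obtain i j where "s i = s j" "i < j"
    unfolding inj_on_def by (metis linorder_neqE_nat)
  then show ?thesis
    by (metis add_diff_inverse_nat less_imp_le_nat not_less zero_less_diff)
qed

text \<open>Used with \<open>d\<close> the least gap at which a walk repeats itself: a window of
  length \<open>d\<close> then yields a cycle without repetitions.\<close>

lemma inj_on_short_interval:
  fixes s :: "nat \<Rightarrow> 'a"
  assumes "\<And>k d'. 0 < d' \<Longrightarrow> d' < d \<Longrightarrow> s k \<noteq> s (k + d')"
  shows "inj_on s {a..<a + d}"
proof (rule linorder_inj_onI)
  fix i j assume "i < j" "i \<in> {a..<a + d}" "j \<in> {a..<a + d}"
  then show "s i \<noteq> s j" using assms[of "j - i" i] by simp
qed auto

text \<open>Without a leaf there is an infinite walk that never turns back, and its shortest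
  repetition is a cycle. Only neighbours in \<open>N\<close> count, so \<open>F\<close> can stay
  fixed while nodes are removed.\<close>

lemma acyclic_graph_leaf:
  assumes "finite N" "N \<noteq> {}" "sym F" "irrefl F" "\<nexists>c. graph_cycle F c"
  shows "\<exists>t\<in>N. \<exists>p. \<forall>s\<in>N. (t, s) \<in> F \<longrightarrow> s = p"
proof (rule ccontr)
  assume "\<not> ?thesis"
  then have next_node: "\<exists>s\<in>N. (t, s) \<in> F \<and> s \<noteq> p" if "t \<in> N" for t p
    using that by blast
  \<comment> \<open>A state is a directed edge, so that the next step can avoid returning to its
    source.\<close>
  define P :: "'a \<times> 'a \<Rightarrow> bool" where "P = (\<lambda>(s, t). (s, t) \<in> F \<and> t \<in> N)"
  have "\<exists>x. P x"
    using \<open>N \<noteq> {}\<close> next_node unfolding P_def by fastforce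
  moreover have "\<exists>y. P y \<and> fst y = snd x \<and> snd y \<noteq> fst x" if "P x" for x
    using next_node[of "snd x" "fst x"] that unfolding P_def by (auto simp: case_prod_beta)
  ultimately obtain h where h: "\<And>n. P (h n)" "\<And>n. fst (h (Suc n)) = snd (h n)"
      "\<And>n. snd (h (Suc n)) \<noteq> fst (h n)"
    using dependent_nat_choice[of "\<lambda>_. P" "\<lambda>_ x y. fst y = snd x \<and> snd y \<noteq> fst x"] by blast
  define s where "s n = snd (h n)" for n
  have edge: "(s n, s (Suc n)) \<in> F" and N: "s n \<in> N" for n
    using h(1)[of "Suc n"] h(1)[of n] h(2)[of n] unfolding P_def s_def by (auto simp: case_prod_beta)
  have no_return: "s (Suc (Suc n)) \<noteq> s n" for n
    using h(2,3) unfolding s_def by metis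
  define d where "d = (LEAST d. 0 < d \<and> (\<exists>i. s i = s (i + d)))"
  have "\<exists>d. 0 < d \<and> (\<exists>i. s i = s (i + d))"
    using sequence_collision[OF \<open>finite N\<close>, of s] N by blast
  then have "0 < d \<and> (\<exists>i. s i = s (i + d))"
    unfolding d_def by (rule LeastI_ex)
  then obtain i where d: "0 < d" "s i = s (i + d)" by blast
  have short: "s k \<noteq> s (k + d')" if "0 < d'" "d' < d" for k d'
    using not_less_Least[of d' "\<lambda>d. 0 < d \<and> (\<exists>i. s i = s (i + d))"] that unfolding d_def by blast
  \<comment> \<open>Gap 1 would be a loop, gap 2 an immediate return.\<close>
  have "d \<noteq> 1" using edge[of i] d \<open>irrefl F\<close> by (auto simp: irrefl_def)
  moreover have "d \<noteq> 2" using no_return[of i] d by auto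
  ultimately have "3 \<le> d" using d by linarith
  moreover have "inj_on s {i..<i + d}" by (rule inj_on_short_interval) (rule short)
  moreover have "(s (i + k), s (i + Suc k mod d)) \<in> F" if "k < d" for k
  proof (cases "Suc k = d")
    case True
    then show ?thesis using edge[of "i + k"] d by auto
  next
    case False
    then show ?thesis using edge[of "i + k"] that by simp
  qed
  ultimately have "graph_cycle F (map s [i..<i + d])"
    unfolding graph_cycle_def by (auto simp: distinct_map)
  then show False using assms by blast
qed

text \<open>A path through \<open>t\<close> enters from \<open>p\<close> and leaves to
  \<open>p\<close>, so the detour can be cut out.\<close>

lemma connected_on_remove_leaf:
  assumes "connected_on F S" "sym F" "irrefl F" and leaf: "\<And>s. s \<in> S \<Longrightarrow> (t, s) \<in> F \<Longrightarrow> s = p"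
  shows "connected_on F (S - {t})"
    and "t \<in> S \<Longrightarrow> S \<noteq> {t} \<Longrightarrow> p \<in> S - {t}"
proof -
  have leaf': "s = p \<and> p \<noteq> t" if "s \<in> S" "(s, t) \<in> F \<or> (t, s) \<in> F" for s
    using that leaf[of s] symD[OF \<open>sym F\<close>, of s t] \<open>irrefl F\<close> by (auto simp: irrefl_def)
  let ?R = "F \<inter> (S - {t}) \<times> (S - {t})"
  \<comment> \<open>A walk currently at \<open>t\<close> is recorded as having reached
    \<open>p\<close>, which carries the induction through \<open>t\<close>.\<close>
  have "(u \<noteq> t \<longrightarrow> (s, u) \<in> ?R\<^sup>*) \<and> (u = t \<longrightarrow> (s, p) \<in> ?R\<^sup>*)"
    if "(s, u) \<in> (F \<inter> S \<times> S)\<^sup>*" "s \<noteq> t" for s u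
    using that
  proof (induction rule: rtrancl_induct)
    case base
    then show ?case by simp
  next
    case (step u w)
    consider "u = t" "w \<noteq> t" | "u \<noteq> t" "w = t" | "u = t" "w = t" | "u \<noteq> t" "w \<noteq> t" by blast
    then show ?case
    proof cases
      case 4
      then have "(u, w) \<in> ?R" using step.hyps by blast
      with 4 step.IH step.prems show ?thesis by (meson rtrancl.rtrancl_into_rtrancl)
    qed (use step leaf'[of u] leaf'[of w] in auto)
  qed
  then show "connected_on F (S - {t})"
    using \<open>connected_on F S\<close> unfolding connected_on_def by blast
  show "p \<in> S - {t}" if t: "t \<in> S" "S \<noteq> {t}"
  proof -
    obtain s where "s \<in> S" "s \<noteq> t" using t by blast
    then have "(t, s) \<in> (F \<inter> S \<times> S)\<^sup>*" "t \<noteq> s"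
      using \<open>connected_on F S\<close> t unfolding connected_on_def by blast+
    then obtain q where "(t, q) \<in> F \<inter> S \<times> S"
      by (meson converse_rtranclE)
    then show ?thesis using leaf'[of q] by blast
  qed
qed

text \<open>The node \<open>p\<close> has to lie in \<open>S\<close> only if \<open>t\<close> does
  and is not alone there; this matches what removing a leaf provides.\<close>

lemma connected_on_add_leaf:
  assumes "connected_on F (S - {t})" "t \<in> S \<Longrightarrow> S \<noteq> {t} \<Longrightarrow> p \<in> S - {t}"
  shows "connected_on (F \<union> {(t, p), (p, t)}) S"
proof -
  let ?R = "(F \<union> {(t, p), (p, t)}) \<inter> S \<times> S"
  have old: "(s, u) \<in> ?R\<^sup>*" if "s \<in> S - {t}" "u \<in> S - {t}" for s u
  proof -
    have "(s, u) \<in> (F \<inter> (S - {t}) \<times> (S - {t}))\<^sup>*"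
      using assms(1) that unfolding connected_on_def by blast
    then show ?thesis by (rule rtrancl_mono[THEN subsetD, rotated]) blast
  qed
  have new: "(t, s) \<in> ?R\<^sup>*" "(s, t) \<in> ?R\<^sup>*" if "t \<in> S" "s \<in> S - {t}" for s
  proof -
    have p: "p \<in> S - {t}" using assms(2) that by blast
    then have "(t, p) \<in> ?R" "(p, t) \<in> ?R" using that by blast+
    with old[OF p that(2)] old[OF that(2) p] show "(t, s) \<in> ?R\<^sup>*" "(s, t) \<in> ?R\<^sup>*"
      by (meson converse_rtrancl_into_rtrancl rtrancl.rtrancl_into_rtrancl)+
  qed
  show ?thesis
    unfolding connected_on_def using old new by (metis Diff_iff rtrancl.rtrancl_refl singletonD)
qed

text \<open>In a cycle through \<open>t\<close> both cyclic neighbours of \<open>t\<close> would be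
  \<open>p\<close>, which is impossible for distinct nodes and length at least 3.\<close>

lemma is_tree_add_leaf:
  assumes "is_tree N F" "p \<in> N" "t \<notin> N"
  shows "is_tree (insert t N) (F \<union> {(t, p), (p, t)})"
proof -
  let ?F = "F \<union> {(t, p), (p, t)}"
  have F: "F \<subseteq> N \<times> N" and acyclic: "\<nexists>c. graph_cycle F c"
    using assms(1) unfolding is_tree_def by auto
  have "\<not> graph_cycle ?F c" for c
  proof
    assume "graph_cycle ?F c"
    then have c: "3 \<le> length c" "distinct c"
        and edge: "\<And>i. i < length c \<Longrightarrow> (c ! i, c ! (Suc i mod length c)) \<in> ?F"
      unfolding graph_cycle_def by auto
    show False
    proof (cases "t \<in> set c")
      case True
      then obtain i where i: "i < length c" "c ! i = t" by (meson in_set_conv_nth)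
      \<comment> \<open>\<open>k\<close> and \<open>l\<close> are the cyclic predecessor and
        successor of the index \<open>i\<close> of \<open>t\<close>.\<close>
      define k where "k = (if i = 0 then length c - 1 else i - 1)"
      define l where "l = Suc i mod length c"
      have k: "k < length c" "Suc k mod length c = i" using i c unfolding k_def by auto
      have l: "l < length c" "l = (if Suc i = length c then 0 else Suc i)"
        using i(1) by (auto simp: l_def mod_Suc)
      have "(t, c ! l) \<in> ?F" using edge[OF i(1)] unfolding l_def i(2) .
      moreover have "(c ! k, t) \<in> ?F" using edge[OF k(1)] unfolding k(2) i(2) .
      ultimately have "c ! k = c ! l" using F assms(2,3) by blast
      then have "k = l" using c(2) k(1) l(1) by (simp add: nth_eq_iff_index_eq)
      then show False using c(1) i(1) l(2) unfolding k_def by (auto split: if_splits)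
    next
      case False
      have "(c ! i, c ! (Suc i mod length c)) \<in> F" if "i < length c" for i
      proof -
        have "Suc i mod length c < length c" using c(1) by (intro mod_less_divisor) linarith
        then have "c ! i \<noteq> t" "c ! (Suc i mod length c) \<noteq> t"
          using False that by (metis nth_mem)+
        then show ?thesis using edge[OF that] by auto
      qed
      then show False using c acyclic unfolding graph_cycle_def by blast
    qed
  qed
  moreover have "connected_on ?F (insert t N)"
    by (rule connected_on_add_leaf) (use assms in \<open>auto simp: is_tree_def\<close>)
  ultimately show ?thesis
    using assms unfolding is_tree_def by (auto simp: sym_def irrefl_def)
qed

lemma is_tree_no_edges:
  assumes "N \<subseteq> {t}"
  shows "is_tree N {}"
proof -
  have "\<not> graph_cycle {} c" for c :: "'a list"
    unfolding graph_cycle_def by (auto intro!: exI[of _ 0])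
  then show ?thesis
    using assms by (auto simp: is_tree_def connected_on_def sym_def irrefl_def finite_subset)
qed

text \<open>Each new hyperedge is hung as a leaf on its \<open>p\<close>. Any vertex it shares with
  earlier hyperedges lies in \<open>p\<close>, so the nodes of that vertex stay connected.\<close>

lemma running_intersection_tree:
  assumes "running_intersection f N"
  shows "\<exists>F. is_tree N F \<and> (\<forall>v. connected_on F {t \<in> N. v \<in> f t})"
  using assms
proof (induction rule: running_intersection.induct)
  case empty
  show ?case using is_tree_no_edges[of "{}"] by (auto simp: connected_on_def)
next
  case (insert N e)
  obtain F where F: "is_tree N F" "\<And>v. connected_on F {t \<in> N. v \<in> f t}"
    using insert.IH by blast
  consider "N = {}" | p where "p \<in> N" "f e \<inter> \<Union>(f ` N) \<subseteq> f p"
    using insert.hyps(3) by blast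
  then show ?case
  proof cases
    case 1
    then show ?thesis
      using is_tree_no_edges[of "{e}" e] by (auto simp: connected_on_def)
  next
    case 2
    have "connected_on (F \<union> {(e, p), (p, e)}) {t \<in> insert e N. v \<in> f t}" for v
    proof (rule connected_on_add_leaf)
      have "{t \<in> insert e N. v \<in> f t} - {e} = {t \<in> N. v \<in> f t}" using insert.hyps by auto
      then show "connected_on F ({t \<in> insert e N. v \<in> f t} - {e})" using F(2) by simp
    qed (use 2 insert.hyps in auto)
    then show ?thesis using is_tree_add_leaf[OF F(1) 2(1) insert.hyps(2)] by blast
  qed
qed

text \<open>Leaves are stripped one by one and listed in reverse. The conditions of
  \<open>is_tree\<close> are spelled out without \<open>F \<subseteq> N \<times> N\<close>, which is
  lost when \<open>N\<close> shrinks and \<open>F\<close> stays.\<close>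

lemma tree_running_intersection:
  assumes "finite N" "sym F" "irrefl F" "\<nexists>c. graph_cycle F c"
    and "connected_on F N" "\<And>v. connected_on F {t \<in> N. v \<in> f t}"
  shows "running_intersection f N"
  using assms(1,5,6)
proof (induction N rule: finite_psubset_induct)
  case (psubset N)
  show ?case
  proof (cases "N = {}")
    case True
    then show ?thesis by (simp add: running_intersection.empty)
  next
    case False
    then obtain t p where t: "t \<in> N" and leaf: "\<And>s. s \<in> N \<Longrightarrow> (t, s) \<in> F \<Longrightarrow> s = p"
      using acyclic_graph_leaf[OF psubset.hyps] assms by meson
    note remove = connected_on_remove_leaf[OF _ assms(2,3), of _ t p]
    have eq: "{s \<in> N - {t}. v \<in> f s} = {s \<in> N. v \<in> f s} - {t}" for v by blast
    have "running_intersection f (N - {t})"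
    proof (rule psubset.IH)
      show "N - {t} \<subset> N" using t by blast
      show "connected_on F (N - {t})" using remove(1)[OF psubset.prems(1)] leaf by blast
      show "connected_on F {s \<in> N - {t}. v \<in> f s}" for v
        unfolding eq using remove(1)[OF psubset.prems(2)] leaf by blast
    qed
    \<comment> \<open>The nodes of a vertex shared by \<open>t\<close> and another node are
      connected, hence include the only neighbour \<open>p\<close> of \<open>t\<close>.\<close>
    moreover have "f t \<inter> \<Union>(f ` (N - {t})) \<subseteq> f p"
      using remove(2)[OF psubset.prems(2)] leaf t by blast
    moreover have "N - {t} = {} \<or> p \<in> N - {t}"
      using remove(2)[OF psubset.prems(1)] leaf t by blast
    ultimately have "running_intersection f (insert t (N - {t}))"
      by (blast intro: running_intersection.insert)
    then show ?thesis using t by (simp add: insert_absorb)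
  qed
qed

lemma alpha_acyclic_iff_running_intersection:
  assumes "finite (labels H)" "\<And>e. e \<in> labels H \<Longrightarrow> vset H e \<subseteq> verts H"
  shows "alpha_acyclic H \<longleftrightarrow> running_intersection (vset H) (labels H)"
proof
  assume "alpha_acyclic H"
  then obtain N :: "nat set" and F \<chi> where tree: "is_tree N F" and bij: "bij_betw \<chi> N (labels H)"
      and conn: "\<And>v. v \<in> verts H \<Longrightarrow> connected_on F {t \<in> N. v \<in> vset H (\<chi> t)}"
    unfolding alpha_acyclic_def is_join_tree_def by blast
  \<comment> \<open>A join tree constrains only members of \<open>verts H\<close>; any other
    \<open>v\<close> lies in no hyperedge.\<close>
  have "connected_on F {t \<in> N. v \<in> vset H (\<chi> t)}" for v
  proof (cases "v \<in> verts H")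
    case False
    then have none: "{t \<in> N. v \<in> vset H (\<chi> t)} = {}"
      using assms(2) bij_betwE[OF bij] by blast
    show ?thesis unfolding none by (simp add: connected_on_def)
  qed (rule conn)
  then have "running_intersection (\<lambda>t. vset H (\<chi> t)) N"
    using tree unfolding is_tree_def by (intro tree_running_intersection) auto
  then show "running_intersection (vset H) (labels H)"
    using running_intersection_image[of "vset H" \<chi> N] bij by (simp add: bij_betw_def)
next
  assume ri: "running_intersection (vset H) (labels H)"
  obtain \<chi> where bij: "bij_betw \<chi> {0..<card (labels H)} (labels H)"
    using ex_bij_betw_nat_finite[OF assms(1)] by blast
  let ?N = "{0..<card (labels H)}"
  let ?\<psi> = "inv_into ?N \<chi>"
  \<comment> \<open>Inserting \<open>\<chi>\<close> after its inverse changes nothing on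
    \<open>labels H\<close>, but gives the form needed to move the listing to natural
    numbers.\<close>
  have "running_intersection (\<lambda>e. vset H (\<chi> (?\<psi> e))) (labels H)"
    using ri by (rule running_intersection_select)
      (use bij_betw_inv_into_right[OF bij] in auto)
  then have "running_intersection (\<lambda>t. vset H (\<chi> t)) (?\<psi> ` labels H)"
    by (rule running_intersection_image) (use bij_betw_inv_into[OF bij] in \<open>auto simp: bij_betw_def\<close>)
  moreover have "?\<psi> ` labels H = ?N"
    using bij_betw_inv_into[OF bij] by (simp add: bij_betw_def)
  ultimately have "\<exists>F. is_tree ?N F \<and> (\<forall>v. connected_on F {t \<in> ?N. v \<in> vset H (\<chi> t)})"
    using running_intersection_tree by metis
  then show "alpha_acyclic H"
    using bij unfolding alpha_acyclic_def is_join_tree_def by blast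
qed

section \<open>Members of \<open>\<tau> H\<close>\<close>

lemma mem_vset_expand:
  "(u, i) \<in> vset (expand H \<sigma>) e \<longleftrightarrow> u \<in> vset H e \<and> 1 \<le> i \<and> i \<le> position H \<sigma> u e"
  unfolding expand_def by auto

lemma labels_expand: "labels (expand H \<sigma>) = labels H"
  unfolding expand_def by simp

lemma alpha_acyclic_expand_iff:
  assumes "H \<in> hypergraphs"
    and \<sigma>: "\<And>u. u \<in> verts H \<Longrightarrow> bij_betw (\<sigma> u) {1..card (star H u)} (star H u)"
  shows "alpha_acyclic (expand H \<sigma>) \<longleftrightarrow> running_intersection (vset (expand H \<sigma>)) (labels H)"
proof -
  have "vset (expand H \<sigma>) e \<subseteq> verts (expand H \<sigma>)" if e: "e \<in> labels H" for e
  proof (clarify)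
    fix u i assume "(u, i) \<in> vset (expand H \<sigma>) e"
    then have u: "u \<in> vset H e" "1 \<le> i" "i \<le> position H \<sigma> u e"
      by (simp_all add: mem_vset_expand)
    then have v: "u \<in> verts H" and "e \<in> star H u"
      using e assms(1) unfolding hypergraphs_def star_def by auto
    then have "position H \<sigma> u e \<in> {1..card (star H u)}"
      unfolding position_def using bij_betwE[OF bij_betw_inv_into[OF \<sigma>[OF v]]] by blast
    with u v show "(u, i) \<in> verts (expand H \<sigma>)"
      unfolding expand_def by auto
  qed
  then show ?thesis
    using alpha_acyclic_iff_running_intersection[of "expand H \<sigma>"] assms(1)
    by (simp add: labels_expand hypergraphs_def)
qed

lemma iota_acyclic_iff:
  assumes "H \<in> hypergraphs"
  shows "iota_acyclic H \<longleftrightarrow>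
    (\<forall>\<sigma>. (\<forall>u\<in>verts H. bij_betw (\<sigma> u) {1..card (star H u)} (star H u)) \<longrightarrow>
      running_intersection (vset (expand H \<sigma>)) (labels H))"
  unfolding iota_acyclic_def tau_def using alpha_acyclic_expand_iff[OF assms] by blast

text \<open>List \<open>A - B\<close> first and then \<open>B\<close>; the threshold is
  \<open>card (A - B) + 1\<close>, which is beyond every position if \<open>B\<close> is
  empty.\<close>

lemma permutation_with_suffix:
  assumes "finite A" "B \<subseteq> A"
  shows "\<exists>s i. bij_betw s {1..card A} A \<and> 1 \<le> i \<and>
    (\<forall>e\<in>A. i \<le> inv_into {1..card A} s e \<longleftrightarrow> e \<in> B)"
proof -
  let ?m = "card (A - B)"
  have "card {1..?m} = card (A - B)" by simp
  then obtain g where g: "bij_betw g {1..?m} (A - B)"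
    using assms(1) by (metis finite_Diff finite_atLeastAtMost finite_same_card_bij)
  have card: "card A = ?m + card B"
    using assms by (simp add: card_Diff_subset card_mono finite_subset)
  then have "card {?m + 1..card A} = card B" by simp
  then obtain h where h: "bij_betw h {?m + 1..card A} B"
    using assms by (metis finite_subset finite_atLeastAtMost finite_same_card_bij)
  define s where "s k = (if k \<le> ?m then g k else h k)" for k
  have low: "bij_betw s {1..?m} (A - B)"
    using g by (rule bij_betw_cong[THEN iffD1, rotated]) (simp add: s_def)
  have high: "bij_betw s {?m + 1..card A} B"
    using h by (rule bij_betw_cong[THEN iffD1, rotated]) (simp add: s_def)
  have "{1..?m} \<union> {?m + 1..card A} = {1..card A}" "A - B \<union> B = A"
    using card assms(2) by auto
  with bij_betw_combine[OF low high] have s: "bij_betw s {1..card A} A"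
    by auto
  have "?m + 1 \<le> inv_into {1..card A} s e \<longleftrightarrow> e \<in> B" if "e \<in> A" for e
  proof -
    let ?k = "inv_into {1..card A} s e"
    have k: "?k \<in> {1..card A}" "s ?k = e"
      using bij_betwE[OF bij_betw_inv_into[OF s]] bij_betw_inv_into_right[OF s that] that by auto
    show ?thesis
    proof (cases "?k \<le> ?m")
      case True
      then show ?thesis using bij_betwE[OF low] k by (metis Diff_iff Suc_eq_plus1 atLeastAtMost_iff not_less_eq_eq)
    next
      case False
      then show ?thesis using bij_betwE[OF high] k by (metis Suc_eq_plus1 atLeastAtMost_iff not_less_eq_eq)
    qed
  qed
  with s show ?thesis by (intro exI[of _ s] exI[of _ "?m + 1"]) simp
qed

text \<open>Each vertex may be deleted from any of its hyperedges, independently of the others, and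
  a listing survives: the copy \<open>(u, i u)\<close> lies exactly in the hyperedges of
  \<open>B u\<close>.\<close>

lemma iota_acyclic_suffixes:
  assumes H: "H \<in> hypergraphs" and "iota_acyclic H"
    and B: "\<And>u. u \<in> verts H \<Longrightarrow> B u \<subseteq> star H u"
  shows "running_intersection (\<lambda>e. {u \<in> verts H. e \<in> B u}) (labels H)"
proof -
  have "\<forall>u\<in>verts H. \<exists>s i. bij_betw s {1..card (star H u)} (star H u) \<and> 1 \<le> i \<and>
      (\<forall>e\<in>star H u. i \<le> inv_into {1..card (star H u)} s e \<longleftrightarrow> e \<in> B u)"
    by (intro ballI permutation_with_suffix B) (use H in \<open>auto simp: hypergraphs_def star_def\<close>)
  then obtain \<sigma> i where \<sigma>: "\<And>u. u \<in> verts H \<Longrightarrow> bij_betw (\<sigma> u) {1..card (star H u)} (star H u)"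
      and i: "\<And>u. u \<in> verts H \<Longrightarrow> 1 \<le> i u"
      and suffix: "\<And>u e. u \<in> verts H \<Longrightarrow> e \<in> star H u \<Longrightarrow> i u \<le> position H \<sigma> u e \<longleftrightarrow> e \<in> B u"
    unfolding position_def by metis
  have "running_intersection (vset (expand H \<sigma>)) (labels H)"
    using assms(2) \<sigma> iota_acyclic_iff[OF H] by blast
  then show ?thesis
  proof (rule running_intersection_select)
    fix u assume "u \<in> (\<Union>e\<in>labels H. {u \<in> verts H. e \<in> B u})"
    then have u: "u \<in> verts H" by blast
    have "e \<in> B u \<longleftrightarrow> (u, i u) \<in> vset (expand H \<sigma>) e" if "e \<in> labels H" for e
      using suffix[OF u, of e] i[OF u] B[OF u] that unfolding mem_vset_expand star_def by blast
    then show "\<exists>w. \<forall>e\<in>labels H. u \<in> {u \<in> verts H. e \<in> B u} \<longleftrightarrow> w \<in> vset (expand H \<sigma>) e"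
      using u by blast
  qed
qed

section \<open>Berge-acyclic hypergraphs are \<open>\<iota>\<close>-acyclic\<close>

text \<open>Otherwise every hyperedge of \<open>L\<close> can be left through a vertex other than
  the one it was entered by. The shortest repetition in the resulting infinite walk is a Berge
  cycle.\<close>

lemma berge_acyclic_leaf:
  assumes "H \<in> hypergraphs" "berge_acyclic H" "L \<subseteq> labels H" "L \<noteq> {}"
  shows "\<exists>e\<in>L. \<exists>u. vset H e \<inter> \<Union>(vset H ` (L - {e})) \<subseteq> {u}"
proof (rule ccontr)
  assume none: "\<not> ?thesis"
  have next_edge: "\<exists>u' e'. e' \<in> L \<and> e' \<noteq> e \<and> u' \<noteq> u \<and> u' \<in> vset H e \<inter> vset H e'" if "e \<in> L" for e u
  proof -
    have "\<not> vset H e \<inter> \<Union>(vset H ` (L - {e})) \<subseteq> {u}" using none that by blast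
    then show ?thesis by blast
  qed
  \<comment> \<open>A state is a hyperedge together with the vertex through which it was
    entered.\<close>
  define Q :: "'a \<times> 'b \<Rightarrow> 'a \<times> 'b \<Rightarrow> bool" where
    "Q x y \<longleftrightarrow> snd y \<noteq> snd x \<and> fst y \<noteq> fst x \<and> fst y \<in> vset H (snd x) \<inter> vset H (snd y)" for x y
  have "\<exists>x. snd x \<in> L" using \<open>L \<noteq> {}\<close> by auto
  moreover have "\<exists>y. snd y \<in> L \<and> Q x y" if "snd x \<in> L" for x
    using next_edge[OF that, of "fst x"] unfolding Q_def by fastforce
  ultimately obtain h where h: "\<And>n. snd (h n) \<in> L" "\<And>n. Q (h n) (h (Suc n))"
    using dependent_nat_choice[of "\<lambda>_ x. snd x \<in> L" "\<lambda>_. Q"] by blast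
  define e v where "e n = snd (h n)" and "v n = fst (h (Suc n))" for n
  have e: "e n \<in> L" "e (Suc n) \<noteq> e n" and v: "v (Suc n) \<noteq> v n"
      and inc: "v n \<in> vset H (e n)" "v n \<in> vset H (e (Suc n))" for n
    using h(1) h(2)[of n] h(2)[of "Suc n"] unfolding e_def v_def Q_def by auto
  have labels: "e n \<in> labels H" and verts: "v n \<in> verts H" for n
    using e(1)[of n] inc(1)[of n] assms(1,3) unfolding hypergraphs_def by auto
  \<comment> \<open>Minimizing over repeated hyperedges and repeated vertices together makes windows
    of length \<open>d\<close> injective in both sequences.\<close>
  let ?C = "\<lambda>d. 0 < d \<and> (\<exists>i. e i = e (i + d) \<or> v i = v (i + d))"
  define d where "d = (LEAST d. ?C d)"
  have "finite (labels H)" using assms(1) by (simp add: hypergraphs_def)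
  then have "\<exists>d. ?C d"
    using sequence_collision[of "labels H" e] labels by blast
  then have "?C d" unfolding d_def by (rule LeastI_ex)
  then obtain i where d: "0 < d" and i: "e i = e (i + d) \<or> v i = v (i + d)" by blast
  have short: "e k \<noteq> e (k + d')" "v k \<noteq> v (k + d')" if "0 < d'" "d' < d" for k d'
    using not_less_Least[of d' ?C] that unfolding d_def by blast+
  have "d \<noteq> 1" using i e(2)[of i] v[of i] by auto
  then have "2 \<le> d" using d by linarith
  have inj: "inj_on e {a..<a + d}" "inj_on v {a..<a + d}" for a
    by (rule inj_on_short_interval, erule (1) short)+
  have shift: "inj_on (\<lambda>k. s (a + k - 1)) {1..d}" if "inj_on s {a..<a + d}"
    for s :: "nat \<Rightarrow> 'c" and a
  proof (rule inj_onI)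
    fix j k assume jk: "j \<in> {1..d}" "k \<in> {1..d}" "s (a + j - 1) = s (a + k - 1)"
    then have "a + j - 1 = a + k - 1" by (intro inj_onD[OF that]) auto
    with jk show "j = k" by auto
  qed
  show False
  proof (cases "e i = e (i + d)")
    case True
    \<comment> \<open>The cycle starts at \<open>e i\<close>; the shift by one is due to Berge
      cycles being counted from 1.\<close>
    let ?e = "\<lambda>k. e (i + k - 1)" and ?v = "\<lambda>k. v (i + k - 1)"
    have "?v k \<in> vset H (?e k) \<inter> vset H (?e (k + 1))" if "k \<in> {1..d}" for k
      using inc[of "i + k - 1"] that by simp
    then have "berge_cycle H d ?e ?v"
      unfolding berge_cycle_def using True \<open>2 \<le> d\<close> shift[OF inj(1)] shift[OF inj(2)] labels verts by auto
    then show False using assms(2) unfolding berge_acyclic_def by blast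
  next
    case False
    then have vi: "v i = v (i + d)" using i by blast
    \<comment> \<open>The cycle starts one hyperedge later and is closed by
      \<open>v (i + d) = v i\<close>, which lies in \<open>e (i + 1)\<close>.\<close>
    let ?e = "\<lambda>k. if k = d + 1 then e (i + 1) else e (i + k)" and ?v = "\<lambda>k. v (i + k)"
    have "inj_on (\<lambda>k. e (i + k)) {1..d}" "inj_on ?v {1..d}"
      using shift[OF inj(1), of "i + 1"] shift[OF inj(2), of "i + 1"] by auto
    moreover have "inj_on ?e {1..d} = inj_on (\<lambda>k. e (i + k)) {1..d}"
      by (rule inj_on_cong) auto
    moreover have "?v k \<in> vset H (?e k) \<inter> vset H (?e (k + 1))" if "k \<in> {1..d}" for k
      using inc[of "i + k"] inc(2)[of i] vi that by auto
    ultimately have "berge_cycle H d ?e ?v"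
      unfolding berge_cycle_def using \<open>2 \<le> d\<close> labels verts by auto
    then show False using assms(2) unfolding berge_acyclic_def by blast
  qed
qed

text \<open>The copies of \<open>u\<close> in a hyperedge form an initial segment, so the largest
  position at \<open>u\<close> gives a segment containing all the others. If no other hyperedge
  contains \<open>u\<close>, nothing is shared and any predecessor serves.\<close>

lemma berge_acyclic_running_intersection_expand:
  assumes "H \<in> hypergraphs" "berge_acyclic H" "finite L" "L \<subseteq> labels H"
  shows "running_intersection (vset (expand H \<sigma>)) L"
  using assms(3,4)
proof (induction L rule: finite_psubset_induct)
  case (psubset L)
  let ?f = "vset (expand H \<sigma>)"
  show ?case
  proof (cases "L = {}")
    case True
    then show ?thesis by (simp add: running_intersection.empty)
  next
    case False
    then obtain e u where e: "e \<in> L" and leaf: "vset H e \<inter> \<Union>(vset H ` (L - {e})) \<subseteq> {u}"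
      using berge_acyclic_leaf[OF assms(1,2) psubset.prems] by blast
    have ri: "running_intersection ?f (L - {e})"
      using e psubset.prems by (intro psubset.IH) auto
    have shared: "w = u \<and> u \<in> vset H q" if "(w, i) \<in> ?f e" "(w, i) \<in> ?f q" "q \<in> L" "q \<noteq> e" for w i q
    proof -
      have "w \<in> vset H e" "w \<in> vset H q" using that(1,2) by (simp_all add: mem_vset_expand)
      with leaf that(3,4) show ?thesis by blast
    qed
    let ?M = "{e' \<in> L - {e}. u \<in> vset H e'}"
    have "L - {e} = {} \<or> (\<exists>p\<in>L - {e}. ?f e \<inter> \<Union>(?f ` (L - {e})) \<subseteq> ?f p)"
    proof (cases "?M = {}")
      case True
      then have "?f e \<inter> \<Union>(?f ` (L - {e})) = {}"
        using shared by fast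
      then show ?thesis by auto
    next
      case False
      have fin: "finite ?M" using psubset.hyps by simp
      then have "Max (position H \<sigma> u ` ?M) \<in> position H \<sigma> u ` ?M"
        using False by (intro Max_in) auto
      then obtain p where p: "p \<in> ?M" "Max (position H \<sigma> u ` ?M) = position H \<sigma> u p" by blast
      have max: "position H \<sigma> u q \<le> position H \<sigma> u p" if "q \<in> ?M" for q
        unfolding p(2)[symmetric] using fin that by (intro Max_ge) auto
      have "?f e \<inter> \<Union>(?f ` (L - {e})) \<subseteq> ?f p"
      proof (rule subrelI)
        fix w i assume "(w, i) \<in> ?f e \<inter> \<Union>(?f ` (L - {e}))"
        then obtain q where wi: "(w, i) \<in> ?f e" "(w, i) \<in> ?f q" and q: "q \<in> L" "q \<noteq> e" by blast
        then have "w = u" "q \<in> ?M" using shared by blast+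
        with wi p(1) max[of q] show "(w, i) \<in> ?f p" by (simp add: mem_vset_expand)
      qed
      with p(1) show ?thesis by blast
    qed
    with ri have "running_intersection ?f (insert e (L - {e}))"
      by (intro running_intersection.insert) auto
    then show ?thesis using e by (simp add: insert_absorb)
  qed
qed

lemma berge_acyclic_imp_iota_acyclic:
  assumes "H \<in> hypergraphs" "berge_acyclic H"
  shows "iota_acyclic H"
  unfolding iota_acyclic_iff[OF assms(1)]
  using berge_acyclic_running_intersection_expand[OF assms] assms(1)
  by (simp add: hypergraphs_def)

section \<open>\<open>\<iota>\<close>-acyclic hypergraphs are \<open>\<gamma>\<close>-acyclic\<close>

text \<open>On a cycle every vertex lies in two different maximal sets, one for each neighbour,
  whereas some vertex must lie in only one.\<close>

lemma running_intersection_imp_cycle_free: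
  fixes H :: "('v, 'e) hypergraph"
  assumes "running_intersection (vset H) (labels H)"
  shows "cycle_free H"
  unfolding cycle_free_def
proof (rule notI, elim exE conjE)
  fix n and v :: "nat \<Rightarrow> 'v"
  assume n: "n \<ge> 3" and inj: "inj_on v {1..n}"
    and max: "maximal_sets (trace H (v ` {1..n})) = {{v i, v (i + 1)} | i. 1 \<le> i \<and> i < n} \<union> {{v n, v 1}}"
  let ?S = "v ` {1..n}"
  let ?f = "\<lambda>e. vset H e \<inter> ?S"
  have trace: "trace H ?S = ?f ` labels H - {{}}"
    unfolding trace_def by auto
  have "{v n, v 1} \<in> maximal_sets (trace H ?S)" using max by blast
  then have "{v n, v 1} \<in> ?f ` labels H"
    unfolding maximal_sets_def trace by blast
  then have "\<Union>(?f ` labels H) \<noteq> {}" by blast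
  moreover have "running_intersection ?f (labels H)"
    using assms by (rule running_intersection_select) auto
  ultimately obtain x where x: "x \<in> \<Union>(?f ` labels H)"
      and unique: "\<And>A B. A \<in> maximal_sets (?f ` labels H) \<Longrightarrow> B \<in> maximal_sets (?f ` labels H) \<Longrightarrow>
        x \<in> A \<Longrightarrow> x \<in> B \<Longrightarrow> A = B"
    using running_intersection_ear by meson
  \<comment> \<open>Restoring the empty set, which \<open>trace\<close> drops, keeps maximal members
    maximal.\<close>
  have maximal: "A \<in> maximal_sets (?f ` labels H)" if "A \<in> maximal_sets (trace H ?S)" for A
    using that unfolding trace maximal_sets_def by blast
  obtain k where k: "x = v k" "k \<in> {1..n}" using x by blast
  \<comment> \<open>\<open>a\<close> and \<open>b\<close> are the cyclic neighbours of
    \<open>k\<close> in \<open>{1..n}\<close>; they differ because \<open>n \<ge> 3\<close>.\<close>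
  define a where "a = (if k = 1 then n else k - 1)"
  define b where "b = (if k = n then 1 else k + 1)"
  have ab: "a \<in> {1..n}" "b \<in> {1..n}" "a \<noteq> b" "a \<noteq> k" "b \<noteq> k"
    using k n unfolding a_def b_def by auto
  have step: "{v j, v (j + 1)} \<in> maximal_sets (trace H ?S)" if "1 \<le> j" "j < n" for j
    unfolding max using that by blast
  have last: "{v n, v 1} \<in> maximal_sets (trace H ?S)"
    unfolding max by blast
  have "{v a, v k} \<in> maximal_sets (trace H ?S)" "{v k, v b} \<in> maximal_sets (trace H ?S)"
    using step[of "k - 1"] step[of k] last k(2) unfolding a_def b_def by (auto simp: insert_commute)
  then have "{v a, v k} = {v k, v b}"
    using maximal unique[of "{v a, v k}" "{v k, v b}"] k(1) by blast
  then show False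
    using ab k(2) inj by (auto simp: doubleton_eq_iff inj_on_eq_iff)
qed

lemma iota_acyclic_imp_gamma_acyclic:
  assumes H: "H \<in> hypergraphs" and iota: "iota_acyclic H"
  shows "gamma_acyclic H"
  unfolding gamma_acyclic_def
proof
  \<comment> \<open>With full stars no incidence is deleted, so \<open>H\<close> itself has a
    listing.\<close>
  have "running_intersection (\<lambda>e. {u \<in> verts H. e \<in> star H u}) (labels H)"
    using H iota by (rule iota_acyclic_suffixes) simp
  then have "running_intersection (vset H) (labels H)"
    by (rule running_intersection_select) (use H in \<open>auto simp: hypergraphs_def star_def\<close>)
  then show "cycle_free H" by (rule running_intersection_imp_cycle_free)
next
  show "\<not> (\<exists>x\<in>verts H. \<exists>y\<in>verts H. \<exists>z\<in>verts H. x \<noteq> y \<and> x \<noteq> z \<and> y \<noteq> z \<and>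
    {{x, y}, {x, z}, {x, y, z}} \<subseteq> trace H {x, y, z})"
  proof (rule notI, elim bexE conjE)
    fix x y z
    assume v: "x \<in> verts H" "y \<in> verts H" "z \<in> verts H" "x \<noteq> y" "x \<noteq> z" "y \<noteq> z"
      and "{{x, y}, {x, z}, {x, y, z}} \<subseteq> trace H {x, y, z}"
    then obtain e1 e2 e3 where e: "e1 \<in> labels H" "e2 \<in> labels H" "e3 \<in> labels H"
        "vset H e1 \<inter> {x, y, z} = {x, y}" "vset H e2 \<inter> {x, y, z} = {x, z}"
        "vset H e3 \<inter> {x, y, z} = {x, y, z}"
      unfolding trace_def by auto
    have mem: "x \<in> vset H e1" "y \<in> vset H e1" "z \<notin> vset H e1" "x \<in> vset H e2" "y \<notin> vset H e2"
        "z \<in> vset H e2" "y \<in> vset H e3" "z \<in> vset H e3"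
    proof -
      have "w \<in> vset H e1 \<longleftrightarrow> w \<in> {x, y}" "w \<in> vset H e2 \<longleftrightarrow> w \<in> {x, z}" "w \<in> vset H e3"
        if "w \<in> {x, y, z}" for w
        using that e(4-6) by blast+
      then show "x \<in> vset H e1" "y \<in> vset H e1" "z \<notin> vset H e1" "x \<in> vset H e2"
          "y \<notin> vset H e2" "z \<in> vset H e2" "y \<in> vset H e3" "z \<in> vset H e3"
        using v(4-6) by simp_all
    qed
    \<comment> \<open>Deleting \<open>x\<close> from all hyperedges but \<open>e1\<close> and
      \<open>e2\<close> leaves every pair covered, but no hyperedge containing all three:
      \<open>e1\<close> misses \<open>z\<close> and \<open>e2\<close> misses
      \<open>y\<close>.\<close>
    define B where "B u = (if u = x then {e1, e2} else star H u)" for u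
    let ?f = "\<lambda>e. {u \<in> verts H. e \<in> B u}"
    have "running_intersection ?f (labels H)"
      using H iota by (rule iota_acyclic_suffixes) (use e mem in \<open>auto simp: B_def star_def\<close>)
    moreover have "{x, y} \<subseteq> ?f e1" "{x, z} \<subseteq> ?f e2" "{y, z} \<subseteq> ?f e3"
      using e mem v unfolding B_def star_def by auto
    ultimately obtain e where "{x, y, z} \<subseteq> ?f e"
      using running_intersection_Helly[of ?f "labels H" x y z] e(1-3) by blast
    then have "e \<in> {e1, e2}" "y \<in> vset H e" "z \<in> vset H e"
      using v unfolding B_def star_def by auto
    with mem show False by blast
  qed
qed

section \<open>Strictness\<close>

lemma iota_acyclic_not_berge_acyclic:
  assumes "a \<noteq> b" "e1 \<noteq> e2"
  defines "H \<equiv> \<lparr>verts = {a, b}, labels = {e1, e2}, vset = \<lambda>_. {a, b}\<rparr>"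
  shows "H \<in> hypergraphs" "iota_acyclic H" "\<not> berge_acyclic H"
proof -
  show H: "H \<in> hypergraphs" unfolding H_def hypergraphs_def by simp
  \<comment> \<open>The second of two hyperedges can always be attached to the first, whatever their
    vertex sets.\<close>
  have "running_intersection f {e1, e2}" for f :: "'b \<Rightarrow> ('a \<times> nat) set"
    using assms(2) by (intro running_intersection.intros) auto
  moreover have "labels H = {e1, e2}" unfolding H_def by simp
  ultimately show "iota_acyclic H" unfolding iota_acyclic_iff[OF H] by metis
  \<comment> \<open>Index 3 falls under the default \<open>e1\<close>, which closes the
    cycle.\<close>
  have "berge_cycle H 2 (\<lambda>i. if i = 2 then e2 else e1) (\<lambda>i. if i = 2 then b else a)"
    unfolding berge_cycle_def H_def using assms(1,2) by (auto simp: inj_on_def)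
  then show "\<not> berge_acyclic H" unfolding berge_acyclic_def by blast
qed

lemma gamma_acyclic_not_iota_acyclic:
  assumes "distinct [a, b, c]" "distinct [e1, e2, e3]"
  defines "H \<equiv> \<lparr>verts = {a, b, c}, labels = {e1, e2, e3}, vset = \<lambda>_. {a, b, c}\<rparr>"
  shows "H \<in> hypergraphs" "gamma_acyclic H" "\<not> iota_acyclic H"
proof -
  show H: "H \<in> hypergraphs" unfolding H_def hypergraphs_def by simp
  have trace: "trace H S \<subseteq> {S}" if "S \<subseteq> verts H" for S
    using that unfolding trace_def H_def by auto
  have "cycle_free H"
    unfolding cycle_free_def
  proof (rule notI, elim exE conjE)
    fix n and v :: "nat \<Rightarrow> 'a"
    assume n: "n \<ge> 3" and inj: "inj_on v {1..n}" and S: "v ` {1..n} \<subseteq> verts H"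
      and max: "maximal_sets (trace H (v ` {1..n})) =
        {{v i, v (i + 1)} | i. 1 \<le> i \<and> i < n} \<union> {{v n, v 1}}"
    have "{v n, v 1} \<in> maximal_sets (trace H (v ` {1..n}))" using max by blast
    then have "{v n, v 1} \<in> trace H (v ` {1..n})" unfolding maximal_sets_def by blast
    \<comment> \<open>A trace here has at most one member, the whole vertex set considered, which
      also contains \<open>v 2\<close>.\<close>
    then have "{v n, v 1} = v ` {1..n}" using trace[OF S] by blast
    moreover have "v 2 \<in> v ` {1..n}" using n by auto
    ultimately have "v 2 = v n \<or> v 2 = v 1" by blast
    then show False using n inj by (auto simp: inj_on_eq_iff)
  qed
  moreover have "\<not> (\<exists>x\<in>verts H. \<exists>y\<in>verts H. \<exists>z\<in>verts H. x \<noteq> y \<and> x \<noteq> z \<and> y \<noteq> z \<and>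
    {{x, y}, {x, z}, {x, y, z}} \<subseteq> trace H {x, y, z})"
  proof (rule notI, elim bexE conjE)
    fix x y z
    assume v: "x \<in> verts H" "y \<in> verts H" "z \<in> verts H" "x \<noteq> z" "y \<noteq> z"
      and "{{x, y}, {x, z}, {x, y, z}} \<subseteq> trace H {x, y, z}"
    then have "{x, y} \<in> trace H {x, y, z}" by simp
    moreover have "trace H {x, y, z} \<subseteq> {{x, y, z}}" using v(1-3) by (intro trace) simp
    ultimately have "{x, y} = {x, y, z}" by (metis singletonD subsetD)
    then have "z \<in> {x, y}" by (metis insertCI)
    with v(4,5) show False by simp
  qed
  ultimately show "gamma_acyclic H" unfolding gamma_acyclic_def ..
  show "\<not> iota_acyclic H"
  proof
    assume iota: "iota_acyclic H"
    \<comment> \<open>The three suffixes turn the hyperedges into the sides of a triangle on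
      \<open>a\<close>, \<open>b\<close>, \<open>c\<close>, violating the Helly property.\<close>
    define B where "B u = (if u = a then {e1, e2} else if u = b then {e2, e3} else {e1, e3})" for u
    let ?f = "\<lambda>e. {u \<in> verts H. e \<in> B u}"
    have "running_intersection ?f (labels H)"
      using H iota by (rule iota_acyclic_suffixes) (auto simp: B_def H_def star_def)
    moreover have "{a, b} \<subseteq> ?f e2" "{a, c} \<subseteq> ?f e1" "{b, c} \<subseteq> ?f e3"
      using assms(1,2) unfolding B_def H_def by auto
    ultimately obtain e where "{a, b, c} \<subseteq> ?f e"
      using running_intersection_Helly[of ?f "labels H" a b c] unfolding H_def by auto
    then show False using assms(1,2) unfolding B_def by auto
  qed
qed

lemma infinite_distinct3: "\<exists>x y z :: 'a::infinite. distinct [x, y, z]"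
proof -
  obtain A :: "'a set" where "card A = 3"
    using infinite_arbitrarily_large[OF infinite_UNIV] by blast
  then show ?thesis by (auto simp: card_3_iff)
qed

theorem corollary6p4:
  shows "(berge_acyclic_class :: ('a, 'b) hypergraph set) \<subseteq> iota_acyclic_class \<and>
         (iota_acyclic_class :: ('a, 'b) hypergraph set) \<subseteq> gamma_acyclic_class \<and>
         (berge_acyclic_class :: ('v::infinite, 'e::infinite) hypergraph set) \<subset> iota_acyclic_class \<and>
         (iota_acyclic_class :: ('v::infinite, 'e::infinite) hypergraph set) \<subset> gamma_acyclic_class"
proof -
  \<comment> \<open>The type variables \<open>'x\<close> and \<open>'y\<close> are generalized, so
    each inclusion serves both the arbitrary and the infinite types.\<close>
  have berge: "(berge_acyclic_class :: ('x, 'y) hypergraph set) \<subseteq> iota_acyclic_class"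
    unfolding berge_acyclic_class_def iota_acyclic_class_def
    using berge_acyclic_imp_iota_acyclic by blast
  have gamma: "(iota_acyclic_class :: ('x, 'y) hypergraph set) \<subseteq> gamma_acyclic_class"
    unfolding gamma_acyclic_class_def iota_acyclic_class_def
    using iota_acyclic_imp_gamma_acyclic by blast
  obtain a b c :: 'v where v: "distinct [a, b, c]" using infinite_distinct3 by blast
  obtain e1 e2 e3 :: 'e where e: "distinct [e1, e2, e3]" using infinite_distinct3 by blast
  have "(berge_acyclic_class :: ('v, 'e) hypergraph set) \<noteq> iota_acyclic_class"
    using iota_acyclic_not_berge_acyclic[of a b e1 e2] v e
    unfolding berge_acyclic_class_def iota_acyclic_class_def by auto
  moreover have "(iota_acyclic_class :: ('v, 'e) hypergraph set) \<noteq> gamma_acyclic_class"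
    using gamma_acyclic_not_iota_acyclic[OF v e]
    unfolding gamma_acyclic_class_def iota_acyclic_class_def by blast
  ultimately show ?thesis by (intro conjI psubsetI berge gamma)
qed

end
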